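(* Suppose that $W\subset\mathbb{R}^n$ is compact, that $\ell:\mathbb{R}^n\times Z\to\mathbb{R}$ is a locally sup-integrable Caratheodory function relative to the probability space $(Z,\mathcal{Z},\mathbb{P})$, and that for every $w\in W$ the random variable $\ell(w,\cdot)-R(w)$ is subgaussian. Then, for any $\alpha\in(0,1)$ and $\gamma>0$, there exists a constant $\beta>0$, independent of $m$, such that for every $m\in\{1,2,\dots\}$ $$\mathbb{P}^m\Big(\sup_{w\in W}\big\{R(w)-R_m^\gamma(w)\big\}\leq\beta m^{-1/2}\Big)\geq 1-\alpha.$$
   Context: Let $(Z,\mathcal{Z},\mathbb{P})$ be a probability space with $Z\subset\mathbb{R}^d$, and let $(Z^m,\mathcal{Z}^m,\mathbb{P}^m)$ be the $m$-fold product probability space, so that the data $(z_1,\dots,z_m)\in Z^m$ is obtained by independent sampling according to $\mathbb{P}$. Let $\|\cdot\|$ be any fixed norm on $\mathbb{R}^n$. $\mathbb{E}$ denotes expectation with respect to $\mathbb{P}$. A function $f:\mathbb{R}^n\times Z\to\mathbb{R}$ is a Caratheodory function relative to $(Z,\mathcal{Z},\mathbb{P})$ if $f(\cdot,z)$ is continuous for every $z\in Z$ and $f(w,\cdot)$ is $\mathcal{Z}$-measurable for every $w\in\mathbb{R}^n$. A Caratheodory function $\ell:\mathbb{R}^n\times Z\to\mathbb{R}$ is locally sup-integrable if for every $\bar w\in\mathbb{R}^n$ there exists $\rho>0$ such that $\int\max\{0,\sup\{\ell(w,z)\mid\|w-\bar w\|\leq\rho\}\}\,d\mathbb{P}(z)<\infty$.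 The true risk is $R(w)=\mathbb{E}[\ell(w,z)]=\int\ell(w,z)\,d\mathbb{P}(z)$. The empirical risk is $R_m(w)=\frac1m\sum_{i=1}^m\ell(w,z_i)$. For $\gamma\geq 0$, the diametrical risk is $R_m^\gamma(w)=\sup_{\|v\|\leq\gamma}R_m(w+v)$. Both $R_m$ and $R_m^\gamma$ are viewed as functions of $w$ and of the random data $(z_1,\dots,z_m)$. A random variable $X$ is subgaussian with variance proxy $\sigma^2$ if $E[X]=0$ and $E[\exp(\tau X)]\leq\exp(\tfrac12\sigma^2\tau^2)$ for all $\tau\in\mathbb{R}$; it is subgaussian if this holds for some finite $\sigma^2$ (for the random variables $\ell(w,\cdot)-R(w)$, the variance proxy may depend on $w$). *)

theory Defs
  imports "HOL-Probability.Probability"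
begin

text \<open>
  The probability space is a measure \<open>M\<close> on \<open>real ^ 'd\<close> with \<open>prob_space M\<close>; its carrier
  \<open>Z = space M\<close> is an arbitrary subset of \<open>real ^ 'd\<close> and its sigma-algebra is arbitrary.
  A loss \<open>l\<close> is a total function, but only its values \<open>l w z\<close> with \<open>z \<in> space M\<close> matter.
  Since \<open>Sup\<close> on \<open>real\<close> is unspecified on empty or unbounded sets, all suprema are taken in \<open>ereal\<close>.
\<close>

text \<open>An arbitrary norm on \<open>real ^ 'n\<close>, not necessarily the Euclidean \<open>norm\<close> of the type class.\<close>

definition norm_on_Rn :: "(real ^ 'n \<Rightarrow> real) \<Rightarrow> bool" where
  "norm_on_Rn N \<longleftrightarrow>
     (\<forall>x. 0 \<le> N x) \<and>
     (\<forall>x. N x = 0 \<longleftrightarrow> x = 0) \<and>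
     (\<forall>c x. N (c *\<^sub>R x) = \<bar>c\<bar> * N x) \<and>
     (\<forall>x y. N (x + y) \<le> N x + N y)"

definition caratheodory :: "(real ^ 'd) measure \<Rightarrow> (real ^ 'n \<Rightarrow> real ^ 'd \<Rightarrow> real) \<Rightarrow> bool" where
  "caratheodory M f \<longleftrightarrow>
     (\<forall>z\<in>space M. continuous_on UNIV (\<lambda>w. f w z)) \<and>
     (\<forall>w. f w \<in> borel_measurable M)"

definition locally_sup_integrable ::
    "(real ^ 'n \<Rightarrow> real) \<Rightarrow> (real ^ 'd) measure \<Rightarrow> (real ^ 'n \<Rightarrow> real ^ 'd \<Rightarrow> real) \<Rightarrow> bool" where
  "locally_sup_integrable N M l \<longleftrightarrow>
     (\<forall>w0. \<exists>\<rho>>0.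
        (\<integral>\<^sup>+ z. e2ennreal (max 0 (SUP w\<in>{w. N (w - w0) \<le> \<rho>}. ereal (l w z))) \<partial>M) < \<infinity>)"

text \<open>The integrability conditions are explicit because the Bochner integral of a
  non-integrable function is \<open>0\<close>.\<close>

definition subgaussian_with_proxy :: "'a measure \<Rightarrow> ('a \<Rightarrow> real) \<Rightarrow> real \<Rightarrow> bool" where
  "subgaussian_with_proxy M X v \<longleftrightarrow>
     integrable M X \<and> integral\<^sup>L M X = 0 \<and>
     (\<forall>\<tau>. integrable M (\<lambda>z. exp (\<tau> * X z)) \<and>
          (\<integral>z. exp (\<tau> * X z) \<partial>M) \<le> exp (1 / 2 * v * \<tau>\<^sup>2))"

definition subgaussian :: "'a measure \<Rightarrow> ('a \<Rightarrow> real) \<Rightarrow> bool" where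
  "subgaussian M X \<longleftrightarrow> (\<exists>\<sigma>. subgaussian_with_proxy M X (\<sigma>\<^sup>2))"

text \<open>Meaningful where \<open>l w\<close> is integrable. This holds whenever \<open>l w - true_risk M l w\<close> is
  subgaussian on a probability space.\<close>

definition true_risk :: "(real ^ 'd) measure \<Rightarrow> (real ^ 'n \<Rightarrow> real ^ 'd \<Rightarrow> real) \<Rightarrow> real ^ 'n \<Rightarrow> real" where
  "true_risk M l w = (\<integral>z. l w z \<partial>M)"

definition empirical_risk ::
    "(real ^ 'n \<Rightarrow> real ^ 'd \<Rightarrow> real) \<Rightarrow> nat \<Rightarrow> (nat \<Rightarrow> real ^ 'd) \<Rightarrow> real ^ 'n \<Rightarrow> real" where
  "empirical_risk l m z w = 1 / real m * (\<Sum>i = 1..m. l w (z i))"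

definition diametrical_risk ::
    "(real ^ 'n \<Rightarrow> real) \<Rightarrow> (real ^ 'n \<Rightarrow> real ^ 'd \<Rightarrow> real) \<Rightarrow> real \<Rightarrow> nat \<Rightarrow>
      (nat \<Rightarrow> real ^ 'd) \<Rightarrow> real ^ 'n \<Rightarrow> ereal" where
  "diametrical_risk N l \<gamma> m z w = (SUP v\<in>{v. N v \<le> \<gamma>}. ereal (empirical_risk l m z (w + v)))"

text \<open>The law \<open>P\<^sup>m\<close> of the data \<open>z 1, \<dots>, z m\<close>.\<close>

definition sample_measure :: "nat \<Rightarrow> 'a measure \<Rightarrow> (nat \<Rightarrow> 'a) measure" where
  "sample_measure m M = PiM {1..m} (\<lambda>_. M)"

end

theory Submission
  imports Defs
begin

text \<open>
  Write \<open>R\<close> for the true risk and \<open>R_m\<close> for the empirical risk. The diametrical risk at \<open>w\<close> dominates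
  \<open>R_m y\<close> for every \<open>y\<close> within \<open>N\<close>-distance \<open>\<gamma>\<close> of \<open>w\<close>. So if \<open>W\<close> contains a finite set \<open>F\<close> such that
  each \<open>w \<in> W\<close> has such a neighbour \<open>y \<in> F\<close> with, in addition, \<open>R w \<le> R y\<close>, then the excess
  \<open>R w - R_m\<^sup>\<gamma> w\<close> never exceeds the largest of the finitely many ordinary deviations \<open>R y - R_m y\<close>,
  \<open>y \<in> F\<close>, where \<open>F\<close> does not depend on \<open>m\<close>.

  Such an \<open>F\<close> exists because \<open>R\<close> is upper semicontinuous on \<open>W\<close> (\<open>upper_semicontinuous_on_true_risk\<close>,
  from Fatou's lemma and local sup-integrability): cover \<open>W\<close> by finitely many small closed cells and
  let \<open>F\<close> consist of one maximizer of \<open>R\<close> per cell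
  (\<open>upper_semicontinuous_on_finite_dominating_net\<close>).

  At a single \<open>y\<close> with variance proxy \<open>v y\<close>, the Chernoff bound with parameter \<open>-1 / sqrt m\<close> gives
  probability at most \<open>exp (v y / 2 - \<beta>)\<close> to a deviation of at least \<open>\<beta> / sqrt m\<close>
  (\<open>subgaussian_sum_tail\<close>). Summing over \<open>F\<close> gives at most \<open>\<alpha>\<close> once \<open>\<beta>\<close> is large, uniformly in \<open>m\<close>.

  The event involves a supremum over the uncountable set \<open>W\<close> of functions that need not be continuous
  in \<open>w\<close>, so its measurability needs an argument. A countable subset of \<open>W\<close> over which the graph of \<open>R\<close>
  is dense suffices to test the supremum (\<open>sets_excess_le\<close>).
\<close>

section \<open>Norms on Euclidean space\<close>

lemma norm_on_Rn_le_norm: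
  fixes N :: "real ^ 'n \<Rightarrow> real"
  assumes "norm_on_Rn N"
  obtains C where "0 < C" "\<And>x. N x \<le> C * norm x"
proof -
  have sc: "N (c *\<^sub>R x) = \<bar>c\<bar> * N x" and tri: "N (x + y) \<le> N x + N y" and nn: "0 \<le> N x" for c x y
    using assms by (auto simp: norm_on_Rn_def)
  have N0: "N 0 = 0" using sc[of 0 0] by simp
  have sum_le: "N (sum g A) \<le> (\<Sum>b\<in>A. N (g b))" if "finite A" for g and A :: "(real^'n) set"
    using that by induction (auto simp: N0 intro: order_trans[OF tri])
  define C where "C = (\<Sum>b\<in>(Basis :: (real^'n) set). N b) + 1"
  have "N x \<le> C * norm x" for x
  proof -
    have "N x = N (\<Sum>b\<in>Basis. (x \<bullet> b) *\<^sub>R b)" by (simp add: euclidean_representation)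
    also have "\<dots> \<le> (\<Sum>b\<in>Basis. \<bar>x \<bullet> b\<bar> * N b)"
      using sum_le[of Basis "\<lambda>b. (x \<bullet> b) *\<^sub>R b"] by (simp add: sc)
    also have "\<dots> \<le> (\<Sum>b\<in>Basis. norm x * N b)"
      by (intro sum_mono mult_right_mono nn) (rule Basis_le_norm)
    also have "\<dots> \<le> C * norm x"
      by (simp add: C_def algebra_simps sum_distrib_left)
    finally show ?thesis .
  qed
  moreover have "0 < C" unfolding C_def using sum_nonneg[of Basis N] nn by (simp add: add_nonneg_pos)
  ultimately show thesis using that by blast
qed

lemma continuous_on_norm_on_Rn:
  assumes "norm_on_Rn N"
  shows "continuous_on S N"
proof -
  obtain C where C: "0 < C" "\<And>x. N x \<le> C * norm x"
    using norm_on_Rn_le_norm[OF assms] by blast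
  have tri: "N (x + y) \<le> N x + N y" for x y
    using assms by (auto simp: norm_on_Rn_def)
  have "N x - N y \<le> C * norm (x - y)" for x y
    using tri[of "x - y" y] C(2)[of "x - y"] by simp
  then have "\<bar>N x - N y\<bar> \<le> C * norm (x - y)" for x y
    by (metis abs_le_iff minus_diff_eq norm_minus_commute)
  then have "C-lipschitz_on S N"
    using C(1) by (intro lipschitz_onI) (auto simp: dist_norm)
  then show ?thesis by (rule lipschitz_on_continuous_on)
qed

text \<open>The minimum of \<open>N\<close> on the Euclidean unit sphere is positive and bounds \<open>N\<close> from below by a
  multiple of the Euclidean norm.\<close>

lemma compact_norm_on_Rn_ball:
  fixes N :: "real ^ 'n \<Rightarrow> real"
  assumes "norm_on_Rn N"
  shows "compact {v. N v \<le> r}"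
proof -
  have sc: "N (c *\<^sub>R x) = \<bar>c\<bar> * N x" and nn: "0 \<le> N x" and z: "N x = 0 \<longleftrightarrow> x = 0" for c x
    using assms by (auto simp: norm_on_Rn_def)
  have "sphere (0::real^'n) 1 \<noteq> {}" by simp
  then obtain s where s: "s \<in> sphere 0 1" "\<And>x. x \<in> sphere 0 1 \<Longrightarrow> N s \<le> N x"
    using continuous_attains_inf[OF compact_sphere _ continuous_on_norm_on_Rn[OF assms], of 0 1] by auto
  have "0 < N s" using nn[of s] z[of s] s(1) by (auto simp: less_le)
  have "norm x * N s \<le> N x" for x
  proof (cases "x = 0")
    case True then show ?thesis using nn by simp
  next
    case False
    have "N s \<le> N (inverse (norm x) *\<^sub>R x)" using False by (intro s(2)) simp
    then show ?thesis using False by (simp add: sc field_simps)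
  qed
  then have "norm x \<le> r / N s" if "N x \<le> r" for x
    using that \<open>0 < N s\<close> by (smt (verit) pos_le_divide_eq)
  then have "bounded {v. N v \<le> r}" by (auto simp: bounded_iff)
  moreover have "closed {v. N v \<le> r}"
    by (intro closed_Collect_le continuous_on_norm_on_Rn assms continuous_intros)
  ultimately show ?thesis by (simp add: compact_eq_bounded_closed)
qed

section \<open>Upper semicontinuous functions on compact sets\<close>

definition upper_semicontinuous_on :: "'a::topological_space set \<Rightarrow> ('a \<Rightarrow> real) \<Rightarrow> bool" where
  "upper_semicontinuous_on K f \<longleftrightarrow> (\<forall>w\<in>K. \<forall>r>f w. \<forall>\<^sub>F y in at w within K. f y < r)"

lemma upper_semicontinuous_on_subset: "upper_semicontinuous_on K f \<Longrightarrow> L \<subseteq> K \<Longrightarrow> upper_semicontinuous_on L f"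
  unfolding upper_semicontinuous_on_def by (meson at_le filter_leD subsetD)

text \<open>If every point \<open>w\<close> had a point \<open>h w\<close> of larger value, the values near \<open>w\<close> would stay below
  \<open>f (h w)\<close>. Finitely many of these neighbourhoods cover \<open>K\<close>, and the best of the corresponding points
  \<open>h w\<close> lies in one of them, hence is beaten by another.\<close>

lemma upper_semicontinuous_on_attains_max:
  assumes "compact K" "K \<noteq> {}" "upper_semicontinuous_on K f"
  obtains y where "y \<in> K" "\<And>w. w \<in> K \<Longrightarrow> f w \<le> f y"
proof (rule ccontr)
  assume "\<not> thesis"
  then have "\<forall>w\<in>K. \<exists>y\<in>K. f w < f y" using that by (meson linorder_not_le)
  then obtain h where h: "\<And>w. w \<in> K \<Longrightarrow> h w \<in> K \<and> f w < f (h w)" by metis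
  have "\<exists>U. open U \<and> w \<in> U \<and> (\<forall>y\<in>U \<inter> K. f y < f (h w))" if "w \<in> K" for w
  proof -
    have "\<forall>\<^sub>F y in at w within K. f y < f (h w)"
      using assms(3) h that by (auto simp: upper_semicontinuous_on_def)
    then obtain U where U: "open U" "w \<in> U" "\<forall>y\<in>U. y \<noteq> w \<longrightarrow> y \<in> K \<longrightarrow> f y < f (h w)"
      by (auto simp: eventually_at_topological)
    have "f y < f (h w)" if "y \<in> U \<inter> K" for y
      using U(3) h[OF \<open>w \<in> K\<close>] that by (cases "y = w") auto
    with U(1,2) show ?thesis by blast
  qed
  then have "\<forall>w\<in>K. \<exists>U. open U \<and> w \<in> U \<and> (\<forall>y\<in>U \<inter> K. f y < f (h w))" by (rule ballI)
  from bchoice[OF this] obtain U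
    where U: "\<forall>w\<in>K. open (U w) \<and> w \<in> U w \<and> (\<forall>y\<in>U w \<inter> K. f y < f (h w))" ..
  obtain D where D: "D \<subseteq> K" "finite D" "K \<subseteq> (\<Union>w\<in>D. U w)"
  proof (rule compactE_image[OF assms(1)])
    show "K \<subseteq> (\<Union>w\<in>K. U w)" using U by auto
  qed (use U in auto)
  then have "D \<noteq> {}" using assms(2) by auto
  have "Max ((\<lambda>w. f (h w)) ` D) \<in> (\<lambda>w. f (h w)) ` D"
    using D(2) \<open>D \<noteq> {}\<close> by (intro Max_in) auto
  then obtain w where w: "w \<in> D" "f (h w) = Max ((\<lambda>w. f (h w)) ` D)" by auto
  have "h w \<in> K" using w(1) D(1) h by blast
  then obtain y where "y \<in> D" "h w \<in> U y" using D(3) by blast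
  then have "f (h w) < f (h y)" using U D(1) \<open>h w \<in> K\<close> by auto
  moreover have "f (h y) \<le> f (h w)" unfolding w(2) using D(2) \<open>y \<in> D\<close> by (intro Max_ge) auto
  ultimately show False by simp
qed

text \<open>One maximizer from each cell of a finite cover of \<open>K\<close> by cells of diameter at most \<open>\<delta>\<close>.\<close>

lemma upper_semicontinuous_on_finite_dominating_net:
  fixes K :: "'a::metric_space set"
  assumes K: "compact K" and f: "upper_semicontinuous_on K f" and "0 < \<delta>"
  obtains F where "finite F" "F \<subseteq> K" "\<And>w. w \<in> K \<Longrightarrow> \<exists>y\<in>F. f w \<le> f y \<and> dist w y \<le> \<delta>"
proof -
  obtain D where D: "D \<subseteq> K" "finite D" "K \<subseteq> (\<Union>x\<in>D. ball x (\<delta> / 2))"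
    using compactE_image[OF K, of K "\<lambda>x. ball x (\<delta> / 2)"] \<open>0 < \<delta>\<close> by force
  have "\<exists>y\<in>K \<inter> cball x (\<delta> / 2). \<forall>w\<in>K \<inter> cball x (\<delta> / 2). f w \<le> f y" if "x \<in> D" for x
  proof (rule upper_semicontinuous_on_attains_max)
    show "compact (K \<inter> cball x (\<delta> / 2))" using K by (intro compact_Int_closed) auto
    show "K \<inter> cball x (\<delta> / 2) \<noteq> {}" using that D(1) \<open>0 < \<delta>\<close> by auto
    show "upper_semicontinuous_on (K \<inter> cball x (\<delta> / 2)) f" by (rule upper_semicontinuous_on_subset[OF f]) auto
  qed blast
  then obtain p where p: "\<And>x. x \<in> D \<Longrightarrow> p x \<in> K \<inter> cball x (\<delta> / 2)"
      "\<And>x w. x \<in> D \<Longrightarrow> w \<in> K \<inter> cball x (\<delta> / 2) \<Longrightarrow> f w \<le> f (p x)"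
    by metis
  show thesis
  proof (rule that[of "p ` D"])
    show "finite (p ` D)" "p ` D \<subseteq> K" using D(2) p(1) by auto
    fix w assume w: "w \<in> K"
    then obtain x where x: "x \<in> D" "dist x w < \<delta> / 2" using D(3) by (force simp: mem_ball)
    have "f w \<le> f (p x)" using p(2)[OF x(1), of w] x(2) w by simp
    moreover have "dist w (p x) \<le> \<delta>"
      using p(1)[OF x(1)] x(2) dist_triangle[of w "p x" x] by (simp add: dist_commute)
    ultimately show "\<exists>y\<in>p ` D. f w \<le> f y \<and> dist w y \<le> \<delta>" using x(1) by blast
  qed
qed

section \<open>Upper semicontinuity of the true risk\<close>

text \<open>Reverse Fatou along a sequence. The supremum in \<open>locally_sup_integrable\<close> is uncountable and so not
  visibly measurable. The supremum \<open>h\<close> along the tail of the sequence is measurable, lies below it, and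
  is therefore an integrable majorant; Fatou's lemma then applies to \<open>h - l (w' j) \<ge> 0\<close>.\<close>

lemma true_risk_le_of_tendsto:
  assumes M: "prob_space M" and N: "norm_on_Rn N" and l: "caratheodory M l"
    and sup: "locally_sup_integrable N M l"
    and int: "integrable M (l w)" "\<And>j. integrable M (l (w' j))"
    and lim: "w' \<longlonglongrightarrow> w" and r: "\<And>j. r \<le> true_risk M l (w' j)"
  shows "r \<le> true_risk M l w"
proof -
  interpret prob_space M by fact
  have [measurable]: "l v \<in> borel_measurable M" for v using l by (auto simp: caratheodory_def)
  have cont: "(\<lambda>j. l (x j) z) \<longlonglongrightarrow> l w z" if "z \<in> space M" "x \<longlonglongrightarrow> w" for x z
    using l that continuous_on_tendsto_compose[of UNIV "\<lambda>w. l w z" x w sequentially]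
    by (auto simp: caratheodory_def)
  obtain C where C: "0 < C" "\<And>x. N x \<le> C * norm x" using norm_on_Rn_le_norm[OF N] by blast
  obtain \<rho> where \<rho>: "0 < \<rho>"
    "(\<integral>\<^sup>+ z. e2ennreal (max 0 (SUP u\<in>{u. N (u - w) \<le> \<rho>}. ereal (l u z))) \<partial>M) < \<infinity>"
    using sup by (auto simp: locally_sup_integrable_def)
  have "\<forall>\<^sub>F j in sequentially. dist (w' j) w < \<rho> / C"
    using lim \<rho>(1) C(1) by (intro tendstoD) auto
  then obtain k where k: "\<And>j. j \<ge> k \<Longrightarrow> dist (w' j) w < \<rho> / C"
    by (auto simp: eventually_sequentially)
  \<comment> \<open>Only this tail is known to stay in the \<open>N\<close>-ball on which the supremum is integrable.\<close>
  define x where "x = (\<lambda>j. w' (j + k))"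
  have xlim: "x \<longlonglongrightarrow> w" unfolding x_def by (rule LIMSEQ_ignore_initial_segment[OF lim])
  have xN: "N (x j - w) \<le> \<rho>" for j
  proof -
    have "N (x j - w) \<le> C * dist (x j) w" using C(2) by (simp add: dist_norm)
    also have "\<dots> \<le> \<rho>" using k[of "j + k"] C(1) by (simp add: x_def field_simps)
    finally show ?thesis .
  qed
  define h where "h = (\<lambda>z. SUP j. max 0 (l (x j) z))"
  have bdd: "bdd_above (range (\<lambda>j. max 0 (l (x j) z)))" if "z \<in> space M" for z
  proof -
    have "(\<lambda>j. max 0 (l (x j) z)) \<longlonglongrightarrow> max 0 (l w z)"
      by (intro tendsto_max tendsto_const cont[OF that xlim])
    then have "Bseq (\<lambda>j. max 0 (l (x j) z))" by (rule convergent_imp_Bseq[OF convergentI])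
    then show ?thesis by (simp add: Bseq_eq_bounded bounded_imp_bdd_above)
  qed
  have [measurable]: "h \<in> borel_measurable M"
    unfolding h_def by (intro borel_measurable_cSUP) (auto simp: bdd)
  have "max 0 (l (x j) z) \<le> h z" if "z \<in> space M" for j z
    unfolding h_def by (rule cSUP_upper[OF UNIV_I bdd[OF that]])
  then have l_le_h: "l (x j) z \<le> h z" and h_nonneg: "0 \<le> h z" if "z \<in> space M" for j z
    using that by (metis max.boundedE)+
  have h_le: "ennreal (h z) \<le> e2ennreal (max 0 (SUP u\<in>{u. N (u - w) \<le> \<rho>}. ereal (l u z)))"
    (is "_ \<le> e2ennreal ?s") if z: "z \<in> space M" for z
  proof -
    have "ereal (h z) = (SUP j. ereal (max 0 (l (x j) z)))"
      unfolding h_def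
    proof (rule ereal_SUP)
      have "(SUP j. ereal (max 0 (l (x j) z))) \<le> ereal (h z)"
        unfolding h_def by (intro SUP_least) (use cSUP_upper[OF UNIV_I bdd[OF z]] in simp)
      moreover have "0 \<le> (SUP j. ereal (max 0 (l (x j) z)))"
        by (rule SUP_upper2[of 0]) (auto simp: zero_ereal_def)
      ultimately show "\<bar>SUP j. ereal (max 0 (l (x j) z))\<bar> \<noteq> \<infinity>" by auto
    qed
    also have "\<dots> \<le> ?s"
    proof (rule SUP_least)
      fix j
      have "ereal (l (x j) z) \<le> ?s"
        by (intro max.coboundedI2 SUP_upper) (simp add: xN)
      moreover have "0 \<le> ?s" by simp
      ultimately show "ereal (max 0 (l (x j) z)) \<le> ?s" unfolding max_def zero_ereal_def by auto
    qed
    finally show ?thesis by (metis e2ennreal_ereal e2ennreal_mono)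
  qed
  have inth: "integrable M h"
  proof (rule integrableI_nonneg)
    have "(\<integral>\<^sup>+ z. ennreal (h z) \<partial>M)
      \<le> (\<integral>\<^sup>+ z. e2ennreal (max 0 (SUP u\<in>{u. N (u - w) \<le> \<rho>}. ereal (l u z))) \<partial>M)"
      by (intro nn_integral_mono h_le)
    then show "(\<integral>\<^sup>+ z. ennreal (h z) \<partial>M) < \<infinity>" using \<rho>(2) by (rule le_less_trans)
  qed (auto intro: h_nonneg)
  have intx: "integrable M (l (x j))" for j unfolding x_def by (rule int)
  have hw: "l w z \<le> h z" if "z \<in> space M" for z
    using cont[OF that xlim] l_le_h[OF that] by (intro LIMSEQ_le_const2) auto
  have "ennreal (\<integral>z. h z - l w z \<partial>M) = (\<integral>\<^sup>+ z. ennreal (h z - l w z) \<partial>M)"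
    using inth int(1) hw by (intro nn_integral_eq_integral[symmetric]) auto
  also have "\<dots> = (\<integral>\<^sup>+ z. liminf (\<lambda>j. ennreal (h z - l (x j) z)) \<partial>M)"
    using cont[OF _ xlim]
    by (intro nn_integral_cong lim_imp_Liminf[symmetric]) (auto intro!: tendsto_intros)
  also have "\<dots> \<le> liminf (\<lambda>j. \<integral>\<^sup>+ z. ennreal (h z - l (x j) z) \<partial>M)"
    by (intro nn_integral_liminf) simp
  also have "\<dots> = liminf (\<lambda>j. ennreal (\<integral>z. h z - l (x j) z \<partial>M))"
    using inth intx l_le_h by (subst nn_integral_eq_integral) auto
  also have "\<dots> \<le> liminf (\<lambda>j. ennreal ((\<integral>z. h z \<partial>M) - r))"
    using inth intx r unfolding x_def
    by (intro Liminf_mono always_eventually allI ennreal_leI) (auto simp: true_risk_def)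
  also have "\<dots> = ennreal ((\<integral>z. h z \<partial>M) - r)" by (simp add: Liminf_const)
  finally have "ennreal ((\<integral>z. h z \<partial>M) - true_risk M l w) \<le> ennreal ((\<integral>z. h z \<partial>M) - r)"
    using inth int(1) by (simp add: true_risk_def)
  \<comment> \<open>\<open>ennreal\<close> truncates negative reals, so the inequality transfers back only with this bound.\<close>
  moreover have "0 \<le> (\<integral>z. h z \<partial>M) - r"
  proof -
    have "r \<le> (\<integral>z. l (x 0) z \<partial>M)" using r[of k] by (simp add: x_def true_risk_def)
    also have "\<dots> \<le> (\<integral>z. h z \<partial>M)" by (intro integral_mono intx inth l_le_h)
    finally show ?thesis by simp
  qed
  ultimately show ?thesis by (simp add: ennreal_le_iff)
qed

lemma upper_semicontinuous_on_true_risk: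
  assumes "prob_space M" "norm_on_Rn N" "caratheodory M l" "locally_sup_integrable N M l"
    and int: "\<And>w. w \<in> W \<Longrightarrow> integrable M (l w)"
  shows "upper_semicontinuous_on W (true_risk M l)"
  unfolding upper_semicontinuous_on_def
proof (intro ballI allI impI, rule sequentially_imp_eventually_within, intro allI impI, elim conjE,
    rule ccontr)
  fix w r x assume w: "w \<in> W" and r: "true_risk M l w < r"
    and x: "\<forall>n. x n \<in> W \<and> x n \<noteq> w" "x \<longlonglongrightarrow> w"
    and "\<not> (\<forall>\<^sub>F n in sequentially. true_risk M l (x n) < r)"
  then obtain s :: "nat \<Rightarrow> nat" where s: "strict_mono s" "\<And>n. \<not> true_risk M l (x (s n)) < r"
    using not_eventually_sequentiallyD by blast
  have "r \<le> true_risk M l w"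
  proof (rule true_risk_le_of_tendsto[OF assms(1-4), where w'="x \<circ> s"])
    show "(x \<circ> s) \<longlonglongrightarrow> w" using x(2) s(1) by (rule LIMSEQ_subseq_LIMSEQ)
  qed (use w x(1) s(2) int in \<open>auto simp: not_less\<close>)
  with r show False by simp
qed

section \<open>The deviation at a single point\<close>

text \<open>With Chernoff parameter \<open>-1 / sqrt m\<close> each factor of the moment generating function is at most
  \<open>exp (v / (2 m))\<close>, so the product of the \<open>m\<close> factors is bounded independently of \<open>m\<close>. The sign of the
  parameter selects the lower tail, where the empirical risk falls short of the true risk.\<close>

lemma subgaussian_sum_tail:
  assumes M: "prob_space M" and X: "subgaussian_with_proxy M X v" and m: "1 \<le> m"
  shows "measure (sample_measure m M)
    {z \<in> space (sample_measure m M). (\<Sum>i = 1..m. X (z i)) \<le> - (t * sqrt (real m))} \<le> exp (v / 2 - t)"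
proof -
  interpret product_sigma_finite "\<lambda>_::nat. M"
    using M by (simp add: product_sigma_finite_def prob_space_imp_sigma_finite)
  define \<tau> where "\<tau> = - 1 / sqrt (real m)"
  define u where "u = (\<lambda>z::nat \<Rightarrow> 'a. \<Prod>i\<in>{1..m}. exp (\<tau> * X (z i)))"
  have int: "integrable M (\<lambda>z. exp (\<tau> * X z))"
    and le: "(\<integral>z. exp (\<tau> * X z) \<partial>M) \<le> exp (1 / 2 * v * \<tau>\<^sup>2)"
    using X by (auto simp: subgaussian_with_proxy_def)
  have intu: "integrable (sample_measure m M) u"
    unfolding sample_measure_def u_def by (intro product_integrable_prod int) auto
  have "{z \<in> space (sample_measure m M). (\<Sum>i = 1..m. X (z i)) \<le> - (t * sqrt (real m))}
      = {z \<in> space (sample_measure m M). exp t \<le> u z}"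
  proof -
    have "u z = exp (- (\<Sum>i = 1..m. X (z i)) / sqrt (real m))" for z
      by (simp add: u_def \<tau>_def sum_divide_distrib flip: exp_sum sum_negf)
    then show ?thesis using m by (auto simp: field_simps)
  qed
  also have "measure (sample_measure m M) \<dots> \<le> (\<integral>z. u z \<partial>sample_measure m M) / exp t"
    by (intro integral_Markov_inequality_measure[where A="{}"] intu) (auto simp: u_def prod_nonneg)
  also have "(\<integral>z. u z \<partial>sample_measure m M) = (\<integral>z. exp (\<tau> * X z) \<partial>M) ^ m"
    unfolding sample_measure_def u_def by (subst product_integral_prod) (auto intro: int)
  also have "\<dots> / exp t \<le> exp (1 / 2 * v * \<tau>\<^sup>2) ^ m / exp t"
    by (intro divide_right_mono power_mono le integral_nonneg) auto
  also have "\<dots> = exp (v / 2 - t)"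
    using m by (simp add: \<tau>_def power_divide exp_diff flip: exp_of_nat_mult)
  finally show ?thesis .
qed

section \<open>The diametrical risk and measurability of the event\<close>

lemma continuous_on_empirical_risk:
  assumes "caratheodory M l" "z \<in> space (sample_measure m M)"
  shows "continuous_on UNIV (empirical_risk l m z)"
proof -
  have "continuous_on UNIV (\<lambda>w. l w (z i))" if "i \<in> {1..m}" for i
    using assms that by (auto simp: caratheodory_def sample_measure_def space_PiM PiE_iff)
  then show ?thesis unfolding empirical_risk_def[abs_def] by (intro continuous_intros)
qed

lemma measurable_empirical_risk:
  assumes "caratheodory M l"
  shows "(\<lambda>z. empirical_risk l m z w) \<in> borel_measurable (sample_measure m M)"
proof -
  have [measurable]: "l w \<in> borel_measurable M" using assms by (auto simp: caratheodory_def)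
  show ?thesis unfolding empirical_risk_def sample_measure_def by measurable
qed

text \<open>By compactness of the \<open>N\<close>-ball, the supremum that defines the diametrical risk is attained.\<close>

lemma le_diametrical_risk_iff:
  assumes N: "norm_on_Rn N" and "0 \<le> \<gamma>" and c: "continuous_on UNIV (empirical_risk l m z)"
  shows "ereal a \<le> diametrical_risk N l \<gamma> m z w \<longleftrightarrow> (\<exists>v. N v \<le> \<gamma> \<and> a \<le> empirical_risk l m z (w + v))"
proof
  have "N 0 = 0" using N by (auto simp: norm_on_Rn_def)
  then have ne: "{v. N v \<le> \<gamma>} \<noteq> {}" using \<open>0 \<le> \<gamma>\<close> by (metis empty_iff mem_Collect_eq)
  have "continuous_on {v. N v \<le> \<gamma>} (\<lambda>v. empirical_risk l m z (w + v))"
    by (intro continuous_on_compose2[OF c] continuous_intros) auto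
  then obtain v where v: "N v \<le> \<gamma>"
      "\<And>u. N u \<le> \<gamma> \<Longrightarrow> empirical_risk l m z (w + u) \<le> empirical_risk l m z (w + v)"
    using continuous_attains_sup[OF compact_norm_on_Rn_ball[OF N] ne] by blast
  have "diametrical_risk N l \<gamma> m z w \<le> ereal (empirical_risk l m z (w + v))"
    unfolding diametrical_risk_def by (rule SUP_least) (simp add: v(2))
  moreover assume "ereal a \<le> diametrical_risk N l \<gamma> m z w"
  ultimately show "\<exists>v. N v \<le> \<gamma> \<and> a \<le> empirical_risk l m z (w + v)"
    using v(1) by (metis ereal_less_eq(3) order_trans)
next
  assume "\<exists>v. N v \<le> \<gamma> \<and> a \<le> empirical_risk l m z (w + v)"
  then show "ereal a \<le> diametrical_risk N l \<gamma> m z w"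
    unfolding diametrical_risk_def by (auto intro: SUP_upper2)
qed

text \<open>By continuity the supremum over the ball can be taken over a countable dense subset.\<close>

lemma measurable_diametrical_risk:
  fixes N :: "real ^ 'n \<Rightarrow> real"
  assumes l: "caratheodory M l"
  shows "(\<lambda>z. diametrical_risk N l \<gamma> m z w) \<in> borel_measurable (sample_measure m M)"
proof -
  obtain T where T: "countable T" "T \<subseteq> {v. N v \<le> \<gamma>}" "{v. N v \<le> \<gamma>} \<subseteq> closure T"
    by (rule separable)
  have "diametrical_risk N l \<gamma> m z w = (SUP v\<in>T. ereal (empirical_risk l m z (w + v)))"
    if z: "z \<in> space (sample_measure m M)" for z
    unfolding diametrical_risk_def
  proof (intro antisym SUP_least)
    fix v assume "v \<in> {v. N v \<le> \<gamma>}"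
    then have "v \<in> closure T" using T(3) by blast
    then obtain x where x: "\<And>j. x j \<in> T" "x \<longlonglongrightarrow> v"
      unfolding closure_sequential by blast
    have "(\<lambda>j. empirical_risk l m z (w + x j)) \<longlonglongrightarrow> empirical_risk l m z (w + v)"
      by (rule continuous_on_tendsto_compose[OF continuous_on_empirical_risk[OF l z]])
         (auto intro!: tendsto_intros x(2))
    then have "(\<lambda>j. ereal (empirical_risk l m z (w + x j))) \<longlonglongrightarrow> ereal (empirical_risk l m z (w + v))"
      by simp
    then show "ereal (empirical_risk l m z (w + v)) \<le> (SUP v\<in>T. ereal (empirical_risk l m z (w + v)))"
      by (rule LIMSEQ_le_const2) (auto intro!: SUP_upper x(1))
  qed (use T(2) in \<open>auto intro: SUP_upper\<close>)
  moreover have "(\<lambda>z. SUP v\<in>T. ereal (empirical_risk l m z (w + v))) \<in> borel_measurable (sample_measure m M)"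
    using measurable_empirical_risk[OF l] by (intro borel_measurable_SUP T(1)) simp
  ultimately show ?thesis by (subst measurable_cong)
qed

text \<open>The diametrical risk is not \<open>-\<infinity>\<close>, since \<open>v = 0\<close> competes, so the subtraction in \<open>ereal\<close> can be undone.\<close>

lemma excess_le_iff:
  assumes N: "norm_on_Rn N" and "0 \<le> \<gamma>"
  shows "(SUP w\<in>W. ereal (R w) - diametrical_risk N l \<gamma> m z w) \<le> ereal c
    \<longleftrightarrow> (\<forall>w\<in>W. ereal (R w - c) \<le> diametrical_risk N l \<gamma> m z w)"
proof -
  have "N 0 = 0" using N by (auto simp: norm_on_Rn_def)
  then have "ereal (empirical_risk l m z (w + 0)) \<le> diametrical_risk N l \<gamma> m z w" for w
    unfolding diametrical_risk_def using \<open>0 \<le> \<gamma>\<close> by (intro SUP_upper) auto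
  then have "diametrical_risk N l \<gamma> m z w \<noteq> - \<infinity>" for w
    by (metis ereal_infty_less_eq(2) MInfty_neq_ereal(1))
  then have "ereal (R w) - diametrical_risk N l \<gamma> m z w \<le> ereal c
      \<longleftrightarrow> ereal (R w - c) \<le> diametrical_risk N l \<gamma> m z w" for w
    by (cases "diametrical_risk N l \<gamma> m z w") (auto simp: algebra_simps)
  then show ?thesis by (simp add: SUP_le_iff)
qed

text \<open>Density in \<open>W\<close> alone would not let the values of an arbitrary \<open>R\<close> converge, which is why the countable
  set is chosen dense in the graph: each \<open>w \<in> W\<close> is then a limit of points \<open>x j\<close> of \<open>D\<close> with
  \<open>R (x j)\<close> tending to \<open>R w\<close>. The perturbations that witness the bound at \<open>x j\<close> stay in a compact ball,
  and a limit point of them witnesses the bound at \<open>w\<close>.\<close>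

lemma sets_excess_le:
  fixes R :: "real ^ 'n \<Rightarrow> real"
  assumes N: "norm_on_Rn N" and \<gamma>: "0 \<le> \<gamma>" and l: "caratheodory M l"
  shows "{z \<in> space (sample_measure m M).
    (SUP w\<in>W. ereal (R w) - diametrical_risk N l \<gamma> m z w) \<le> ereal c} \<in> sets (sample_measure m M)"
proof -
  obtain G where G: "countable G" "G \<subseteq> (\<lambda>w. (w, R w)) ` W" "(\<lambda>w. (w, R w)) ` W \<subseteq> closure G"
    by (rule separable)
  define D where "D = fst ` G"
  have D: "countable D" "D \<subseteq> W" using G(1,2) by (auto simp: D_def)
  have all_W: "ereal (R w - c) \<le> diametrical_risk N l \<gamma> m z w"
    if z: "z \<in> space (sample_measure m M)" and w: "w \<in> W"
      and all_D: "\<forall>w\<in>D. ereal (R w - c) \<le> diametrical_risk N l \<gamma> m z w" for z w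
  proof -
    note cont = continuous_on_empirical_risk[OF l z]
    note le_iff = le_diametrical_risk_iff[OF N \<gamma> cont]
    have "(w, R w) \<in> closure G" using G(3) w by blast
    then obtain g where g: "\<And>j. g j \<in> G" "g \<longlonglongrightarrow> (w, R w)"
      unfolding closure_sequential by blast
    define x where "x = (\<lambda>j. fst (g j))"
    have "g j = (x j, R (x j))" for j
      using subsetD[OF G(2) g(1)[of j]] by (auto simp: x_def)
    then have lim: "x \<longlonglongrightarrow> w" "(\<lambda>j. R (x j)) \<longlonglongrightarrow> R w"
      using tendsto_fst[OF g(2)] tendsto_snd[OF g(2)] by simp_all
    have "x j \<in> D" for j using g(1) by (simp add: x_def D_def)
    then have "\<exists>v. N v \<le> \<gamma> \<and> R (x j) - c \<le> empirical_risk l m z (x j + v)" for j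
      using all_D le_iff by blast
    then obtain v where v: "\<And>j. N (v j) \<le> \<gamma>" "\<And>j. R (x j) - c \<le> empirical_risk l m z (x j + v j)"
      by metis
    obtain v0 s where v0: "N v0 \<le> \<gamma>" and s: "strict_mono (s :: nat \<Rightarrow> nat)" "(v \<circ> s) \<longlonglongrightarrow> v0"
      using seq_compactE[OF compact_imp_seq_compact[OF compact_norm_on_Rn_ball[OF N, of \<gamma>]], of v] v(1)
      by auto
    have "(\<lambda>j. empirical_risk l m z (x (s j) + v (s j))) \<longlonglongrightarrow> empirical_risk l m z (w + v0)"
      using LIMSEQ_subseq_LIMSEQ[OF lim(1) s(1)] s(2)
      by (intro continuous_on_tendsto_compose[OF cont] tendsto_add) (auto simp: o_def)
    moreover have "(\<lambda>j. R (x (s j)) - c) \<longlonglongrightarrow> R w - c"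
      using LIMSEQ_subseq_LIMSEQ[OF lim(2) s(1)] by (intro tendsto_intros) (simp add: o_def)
    ultimately have "R w - c \<le> empirical_risk l m z (w + v0)"
      using v(2) by (intro LIMSEQ_le) auto
    then show ?thesis using le_iff v0 by blast
  qed
  have "{z \<in> space (sample_measure m M).
      (SUP w\<in>W. ereal (R w) - diametrical_risk N l \<gamma> m z w) \<le> ereal c}
    = {z \<in> space (sample_measure m M). \<forall>w\<in>D. ereal (R w - c) \<le> diametrical_risk N l \<gamma> m z w}"
    unfolding excess_le_iff[OF N \<gamma>] using all_W D(2) by blast
  moreover have "\<dots> \<in> sets (sample_measure m M)"
    using D(1) measurable_diametrical_risk[OF l, of N \<gamma> m] by measurable
  ultimately show ?thesis by simp
qed

section \<open>Rate of convergence for the diametrical risk\<close>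

theorem theorem3p3:
  fixes M :: "(real ^ 'd) measure"
    and N :: "real ^ 'n \<Rightarrow> real"
    and l :: "real ^ 'n \<Rightarrow> real ^ 'd \<Rightarrow> real"
    and W :: "(real ^ 'n) set"
    and \<alpha> \<gamma> :: real
  assumes "prob_space M"
    and "norm_on_Rn N"
    and "compact W"
    and "caratheodory M l"
    and "locally_sup_integrable N M l"
    and "\<And>w. w \<in> W \<Longrightarrow> subgaussian M (\<lambda>z. l w z - true_risk M l w)"
    and "0 < \<alpha>" and "\<alpha> < 1" and "0 < \<gamma>"
  shows "\<exists>\<beta>>0. \<forall>m::nat. m \<ge> 1 \<longrightarrow>
    measure (sample_measure m M)
      {z \<in> space (sample_measure m M).
        (SUP w\<in>W. ereal (true_risk M l w) - diametrical_risk N l \<gamma> m z w)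
          \<le> ereal (\<beta> * real m powr (- 1 / 2))} \<ge> 1 - \<alpha>"
proof -
  note N = \<open>norm_on_Rn N\<close> and l = \<open>caratheodory M l\<close>
  interpret prob_space M by fact
  let ?R = "true_risk M l"
  have int: "integrable M (l w)" if "w \<in> W" for w
  proof -
    have "integrable M (\<lambda>z. l w z - ?R w)"
      using assms(6)[OF that] by (auto simp: subgaussian_def subgaussian_with_proxy_def)
    then have "integrable M (\<lambda>z. (l w z - ?R w) + ?R w)" by (intro Bochner_Integration.integrable_add) auto
    then show ?thesis by simp
  qed
  obtain C where C: "0 < C" "\<And>x. N x \<le> C * norm x" using norm_on_Rn_le_norm[OF N] by blast
  have "upper_semicontinuous_on W ?R" by (rule upper_semicontinuous_on_true_risk[OF assms(1,2,4,5) int])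
  then obtain F where F: "finite F" "F \<subseteq> W"
      "\<And>w. w \<in> W \<Longrightarrow> \<exists>y\<in>F. ?R w \<le> ?R y \<and> dist w y \<le> \<gamma> / C"
    using upper_semicontinuous_on_finite_dominating_net[OF \<open>compact W\<close>, of ?R "\<gamma> / C"] \<open>0 < \<gamma>\<close> C(1) by auto
  have "\<exists>v. subgaussian_with_proxy M (\<lambda>z. l y z - ?R y) v" if "y \<in> F" for y
    using assms(6) that F(2) by (auto simp: subgaussian_def)
  then obtain v where v: "\<And>y. y \<in> F \<Longrightarrow> subgaussian_with_proxy M (\<lambda>z. l y z - ?R y) (v y)"
    by metis
  define S where "S = (\<Sum>y\<in>F. exp (v y / 2))"
  \<comment> \<open>Chosen so that \<open>S * exp (- \<beta>) \<le> \<alpha>\<close>; the summand 1 keeps \<open>\<beta>\<close> positive even when \<open>F\<close> is empty.\<close>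
  define \<beta> where "\<beta> = ln ((S + 1) / \<alpha>)"
  have "0 \<le> S" by (simp add: S_def sum_nonneg)
  then have "1 < (S + 1) / \<alpha>" using \<open>0 < \<alpha>\<close> \<open>\<alpha> < 1\<close> by (simp add: field_simps)
  then have "0 < \<beta>" by (simp add: \<beta>_def)
  have S_le: "S * exp (- \<beta>) \<le> \<alpha>"
    using \<open>0 \<le> S\<close> \<open>0 < \<alpha>\<close> \<open>1 < (S + 1) / \<alpha>\<close> by (simp add: \<beta>_def exp_minus field_simps)
  show ?thesis
  proof (intro exI conjI allI impI)
    fix m :: nat assume m: "1 \<le> m"
    let ?P = "sample_measure m M"
    let ?c = "\<beta> * real m powr (- 1 / 2)"
    let ?good = "{z \<in> space ?P. (SUP w\<in>W. ereal (?R w) - diametrical_risk N l \<gamma> m z w) \<le> ereal ?c}"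
    let ?bad = "\<lambda>y. {z \<in> space ?P. (\<Sum>i = 1..m. l y (z i) - ?R y) \<le> - (\<beta> * sqrt (real m))}"
    interpret P: prob_space ?P
      unfolding sample_measure_def by (intro prob_space_PiM assms(1))
    have good_sets: "?good \<in> sets ?P" by (rule sets_excess_le[OF N _ l]) (use \<open>0 < \<gamma>\<close> in simp)
    have bad_sets: "?bad y \<in> sets ?P" for y
    proof -
      have [measurable]: "l y \<in> borel_measurable M" using l by (auto simp: caratheodory_def)
      show ?thesis unfolding sample_measure_def by measurable
    qed
    have c: "?c = \<beta> / sqrt (real m)" 
      using powr_minus_divide[of "real m" "1 / 2"] m by (simp add: powr_half_sqrt)
    have "space ?P - ?good \<subseteq> (\<Union>y\<in>F. ?bad y)"
    proof
      fix z assume "z \<in> space ?P - ?good"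
      then have z: "z \<in> space ?P" and "z \<notin> ?good" by auto
      then obtain w where w: "w \<in> W" "\<not> ereal (?R w - ?c) \<le> diametrical_risk N l \<gamma> m z w"
        using excess_le_iff[OF N less_imp_le[OF \<open>0 < \<gamma>\<close>]] by blast
      obtain y where y: "y \<in> F" "?R w \<le> ?R y" "dist w y \<le> \<gamma> / C" using F(3)[OF w(1)] by blast
      have "N (y - w) \<le> C * dist w y" using C(2)[of "y - w"] by (simp add: dist_norm norm_minus_commute)
      also have "\<dots> \<le> \<gamma>" using y(3) C(1) by (simp add: field_simps)
      finally have "\<not> ?R w - ?c \<le> empirical_risk l m z (w + (y - w))"
        using w(2) le_diametrical_risk_iff[OF N _ continuous_on_empirical_risk[OF l z]] \<open>0 < \<gamma>\<close>
        by (metis less_imp_le)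
      then have "empirical_risk l m z y \<le> ?R y - \<beta> / sqrt (real m)" using y(2) c by simp
      then have "real m * empirical_risk l m z y \<le> real m * (?R y - \<beta> / sqrt (real m))"
        by (rule mult_left_mono) simp
      moreover have "real m * empirical_risk l m z y = (\<Sum>i = 1..m. l y (z i))"
        using m by (simp add: empirical_risk_def)
      moreover have "real m * (\<beta> / sqrt (real m)) = \<beta> * sqrt (real m)"
        using m by (simp add: field_simps)
      ultimately have "z \<in> ?bad y" using z by (simp add: sum_subtractf algebra_simps)
      then show "z \<in> (\<Union>y\<in>F. ?bad y)" using y(1) by blast
    qed
    then have "measure ?P (space ?P - ?good) \<le> measure ?P (\<Union>y\<in>F. ?bad y)"
      using F(1) bad_sets by (intro P.finite_measure_mono) auto
    also have "\<dots> \<le> (\<Sum>y\<in>F. measure ?P (?bad y))"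
      using F(1) bad_sets by (intro P.finite_measure_subadditive_finite) auto
    also have "\<dots> \<le> (\<Sum>y\<in>F. exp (v y / 2 - \<beta>))"
      by (intro sum_mono subgaussian_sum_tail assms(1) v m)
    also have "\<dots> = S * exp (- \<beta>)"
      by (simp add: S_def sum_distrib_right flip: exp_add)
    finally show "1 - \<alpha> \<le> measure ?P ?good" using S_le P.prob_compl[OF good_sets] by simp
  qed fact
qed

end
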